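(* Let $\varepsilon>0$ be a real number, let $d_0\ge 2$ be an integer, let $a=(2d_0-1)/d_0+\varepsilon$, let $c>0$ be a real number, and let $b=p/2$ for $p>2$ an odd integer. If $2a+p-\varepsilon/2<pc$, then there always exists a convex generator $\Lambda$ such that $\Lambda\le_{P(a,1),E(bc,c)} e_{p,2}^{d_0}$.
   Context: A convex integral path is a path $\Lambda$ in the plane with endpoints $(0,y(\Lambda))$ and $(x(\Lambda),0)$, where $x(\Lambda),y(\Lambda)\ge 0$ are integers, which is the graph of a piecewise linear concave function $f:[0,x(\Lambda)]\to[0,y(\Lambda)]$ with $f'(0)\le 0$, possibly together with a vertical line segment at the right, and all of whose vertices (endpoints and points of slope change) are lattice points; its edges are the segments between consecutive vertices. A convex generator is a convex integral path each of whose edges is labeled "$e$" or "$h$", with horizontal and vertical edges labeled only "$e$". For relatively prime nonnegative integers $r,s$ and a positive integer $m$: $e_{r,s}^m$ denotes an edge with displacement vector $(mr,-ms)$ labeled "$e$"; $h_{r,s}$ denotes an edge with displacement $(r,-s)$ labeled "$h$"; and $e_{r,s}^{m-1}h_{r,s}$ ($m>1$) denotes an edge with displacement $(mr,-ms)$ labeled "$h$". A convex generator is identified with the commutative formal product of these symbols over its edges. $m(\Lambda)$ is the total exponent of all factors in the formal product (one less than the number of lattice points on $\Lambda$); $L(\Lambda)$ is the number of lattice points in the region enclosed by $\Lambda$ and the axes, boundary included; $h(\Lambda)$ is the number of edges labeled "$h$"; the ECH index is $I(\Lambda)=2(L(\Lambda)-1)-h(\Lambda)$. Symplectic actions: for the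 polydisk $P(a,1)$ (the toric domain over the rectangle $[0,a]\times[0,1]$), $A_{P(a,1)}(\Lambda)=x(\Lambda)+a\,y(\Lambda)$; for the ellipsoid $E(bc,c)$ (the toric domain over the triangle with vertices $(0,0),(bc,0),(0,c)$), $A_{E(bc,c)}(\Lambda)=\max\{cx+bcy:(x,y)\in\Lambda\}$. For convex generators $\Lambda,\Lambda'$ with all edges of $\Lambda'$ labeled "$e$", one writes $\Lambda\le_{P(a,1),E(bc,c)}\Lambda'$ if: (i) $I(\Lambda)=I(\Lambda')$; (ii) $A_{P(a,1)}(\Lambda)\le A_{E(bc,c)}(\Lambda')$; (iii) $x(\Lambda)+y(\Lambda)-\frac{h(\Lambda)}{2}\ge x(\Lambda')+y(\Lambda')+m(\Lambda')-1$. *)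

theory Defs
  imports "HOL-Analysis.Analysis"
begin

text \<open>
  Piecewise linearity: a finite cover by \<^emph>\<open>closed\<close> intervals on which \<open>f\<close> is affine, so that
  continuity is included.
\<close>

definition piecewise_linear_on :: "real set \<Rightarrow> (real \<Rightarrow> real) \<Rightarrow> bool" where
  "piecewise_linear_on S f \<longleftrightarrow>
     (\<exists>P. finite P \<and> \<Union>P = S \<and>
       (\<forall>J\<in>P. (\<exists>u v. J = {u..v}) \<and> (\<exists>\<alpha> \<beta>. \<forall>t\<in>J. f t = \<alpha> * t + \<beta>)))"

text \<open>
  A path is represented by its set of points in the plane.  Its vertices (the endpoints and the
  points of slope change) are the points that are not interior to a straight piece of the path.
\<close>

definition vertices :: "(real \<times> real) set \<Rightarrow> (real \<times> real) set" where
  "vertices \<Lambda> = {v \<in> \<Lambda>. \<not> (\<exists>q r. v \<in> open_segment q r \<and> closed_segment q r \<subseteq> \<Lambda>)}"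

text \<open>
  An edge is recorded as the pair (upper left endpoint, lower right endpoint).  No third vertex
  lies on it, since such a vertex would be interior to a straight piece.
\<close>

definition edges :: "(real \<times> real) set \<Rightarrow> ((real \<times> real) \<times> (real \<times> real)) set" where
  "edges \<Lambda> = {(v, w). v \<in> vertices \<Lambda> \<and> w \<in> vertices \<Lambda> \<and> v \<noteq> w \<and>
                 fst v \<le> fst w \<and> snd w \<le> snd v \<and> closed_segment v w \<subseteq> \<Lambda>}"

text \<open>
  The vertical segment at the right degenerates to the endpoint when \<open>f x = 0\<close>.  For \<open>x = 0\<close> the
  condition on the one-sided derivative is vacuous, the filter being trivial.
\<close>

definition convex_integral_path_on :: "nat \<Rightarrow> nat \<Rightarrow> (real \<times> real) set \<Rightarrow> bool" where
  "convex_integral_path_on x y \<Lambda> \<longleftrightarrow>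
     (\<exists>f :: real \<Rightarrow> real.
        f ` {0..real x} \<subseteq> {0..real y} \<and> f 0 = real y \<and>
        piecewise_linear_on {0..real x} f \<and> concave_on {0..real x} f \<and>
        (\<exists>D\<le>0. (f has_real_derivative D) (at 0 within {0..real x})) \<and>
        \<Lambda> = (\<lambda>t. (t, f t)) ` {0..real x} \<union> {real x} \<times> {0..f (real x)}) \<and>
     vertices \<Lambda> \<subseteq> \<int> \<times> \<int>"

definition convex_integral_path :: "(real \<times> real) set \<Rightarrow> bool" where
  "convex_integral_path \<Lambda> \<longleftrightarrow> (\<exists>x y. convex_integral_path_on x y \<Lambda>)"

text \<open>The labeling is given by the set of edges labeled \<open>h\<close>; all other edges are labeled \<open>e\<close>.\<close>

record labeled_path =
  curve :: "(real \<times> real) set"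
  h_edges :: "((real \<times> real) \<times> (real \<times> real)) set"

definition convex_generator :: "labeled_path \<Rightarrow> bool" where
  "convex_generator \<Lambda> \<longleftrightarrow>
     convex_integral_path (curve \<Lambda>) \<and> h_edges \<Lambda> \<subseteq> edges (curve \<Lambda>) \<and>
     (\<forall>(v, w) \<in> h_edges \<Lambda>. fst v \<noteq> fst w \<and> snd v \<noteq> snd w)"

text \<open>The generator \<open>e\<^bsub>r,s\<^esub>\<^sup>m\<close>, for coprime \<open>r\<close>, \<open>s\<close> and positive \<open>m\<close>.\<close>

definition e_power :: "nat \<Rightarrow> nat \<Rightarrow> nat \<Rightarrow> labeled_path" where
  "e_power r s m =
     \<lparr> curve = closed_segment (0, real (m * s)) (real (m * r), 0), h_edges = {} \<rparr>"

text \<open>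
  The endpoints \<open>(0, y(\<Lambda>))\<close> and \<open>(x(\<Lambda>), 0)\<close>.  A supremum is used because a path may contain a
  segment of a coordinate axis.
\<close>

definition x_end :: "labeled_path \<Rightarrow> real" where
  "x_end \<Lambda> = Sup (fst ` curve \<Lambda>)"

definition y_end :: "labeled_path \<Rightarrow> real" where
  "y_end \<Lambda> = Sup (snd ` curve \<Lambda>)"

lemma
  assumes "convex_integral_path_on x y (curve \<Lambda>)"
  shows x_end_eq: "x_end \<Lambda> = real x" and y_end_eq: "y_end \<Lambda> = real y"
proof -
  obtain f where f: "f ` {0..real x} \<subseteq> {0..real y}" "f 0 = real y"
    and c: "curve \<Lambda> = (\<lambda>t. (t, f t)) ` {0..real x} \<union> {real x} \<times> {0..f (real x)}"
    using assms unfolding convex_integral_path_on_def by auto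
  have fx: "0 \<le> f t \<and> f t \<le> real y" if "0 \<le> t" "t \<le> real x" for t
    using f(1) that by (auto simp: image_subset_iff)
  have f_end: "f (real x) \<le> real y"
    using fx[of "real x"] by simp
  have "(real x, 0) \<in> curve \<Lambda>"
    unfolding c using fx[of "real x"] by simp
  then have x: "real x \<in> fst ` curve \<Lambda>"
    by (rule rev_image_eqI) simp
  have "(0, real y) \<in> curve \<Lambda>"
    unfolding c by (rule UnI1, rule image_eqI[where x = 0]) (simp_all add: f(2))
  then have y: "real y \<in> snd ` curve \<Lambda>"
    by (rule rev_image_eqI) simp
  have q: "fst q \<le> real x \<and> snd q \<le> real y" if "q \<in> curve \<Lambda>" for q
  proof -
    from that consider t where "t \<in> {0..real x}" "q = (t, f t)"
      | "fst q = real x" "snd q \<le> f (real x)"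
      unfolding c by (cases q) auto
    then show ?thesis
      using fx by cases (auto intro: order_trans[OF _ f_end])
  qed
  show "x_end \<Lambda> = real x"
    unfolding x_end_def using x q by (intro cSup_eq_maximum) blast+
  show "y_end \<Lambda> = real y"
    unfolding y_end_def using y q by (intro cSup_eq_maximum) blast+
qed

definition enclosed_region :: "(real \<times> real) set \<Rightarrow> (real \<times> real) set" where
  "enclosed_region \<Lambda> = {(u, v). 0 \<le> v \<and> (\<exists>v'\<ge>v. (u, v') \<in> \<Lambda>)}"

definition lattice_count :: "labeled_path \<Rightarrow> nat" where
  "lattice_count \<Lambda> = card ((\<int> \<times> \<int>) \<inter> enclosed_region (curve \<Lambda>))"

definition h_count :: "labeled_path \<Rightarrow> nat" where
  "h_count \<Lambda> = card (h_edges \<Lambda>)"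

definition ech_index :: "labeled_path \<Rightarrow> int" where
  "ech_index \<Lambda> = 2 * (int (lattice_count \<Lambda>) - 1) - int (h_count \<Lambda>)"

text \<open>
  An edge with displacement \<open>(m r, - m s)\<close>, where \<open>r\<close> and \<open>s\<close> are coprime, contributes \<open>m\<close> to the
  total exponent, whether it is labeled \<open>e\<close> or \<open>h\<close>.  Between vertices of a convex integral path
  both displacements are integers, so the floors only change the type.
\<close>

definition edge_exponent :: "(real \<times> real) \<times> (real \<times> real) \<Rightarrow> nat" where
  "edge_exponent = (\<lambda>(v, w). nat (gcd \<lfloor>fst w - fst v\<rfloor> \<lfloor>snd v - snd w\<rfloor>))"

definition total_exponent :: "labeled_path \<Rightarrow> nat" where
  "total_exponent \<Lambda> = (\<Sum>k\<in>edges (curve \<Lambda>). edge_exponent k)"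

text \<open>Symplectic actions for \<open>P(a, 1)\<close> and \<open>E(b c, c)\<close>.\<close>

definition polydisk_action :: "real \<Rightarrow> labeled_path \<Rightarrow> real" where
  "polydisk_action a \<Lambda> = x_end \<Lambda> + a * y_end \<Lambda>"

text \<open>The supremum is attained, since a convex integral path is compact.\<close>

definition ellipsoid_action :: "real \<Rightarrow> real \<Rightarrow> labeled_path \<Rightarrow> real" where
  "ellipsoid_action b c \<Lambda> = (SUP (x, y) \<in> curve \<Lambda>. c * x + b * c * y)"

text \<open>The relation \<open>\<Lambda> \<le>\<^bsub>P(a,1),E(bc,c)\<^esub> \<Lambda>'\<close>.\<close>

definition generator_le ::
  "real \<Rightarrow> real \<Rightarrow> real \<Rightarrow> labeled_path \<Rightarrow> labeled_path \<Rightarrow> bool" where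
  "generator_le a b c \<Lambda> \<Lambda>' \<longleftrightarrow>
     convex_generator \<Lambda> \<and> convex_generator \<Lambda>' \<and> h_edges \<Lambda>' = {} \<and>
     ech_index \<Lambda> = ech_index \<Lambda>' \<and>
     polydisk_action a \<Lambda> \<le> ellipsoid_action b c \<Lambda>' \<and>
     x_end \<Lambda> + y_end \<Lambda> - real (h_count \<Lambda>) / 2
       \<ge> x_end \<Lambda>' + y_end \<Lambda>' + real (total_exponent \<Lambda>') - 1"

end

theory Submission
  imports Defs
begin

text \<open>
  All edges of the generator are labeled \<open>e\<close>, and its endpoints are \<open>(0, d)\<close> and \<open>(x, 0)\<close> with
  \<open>d = d\<^sub>0\<close> and \<open>x = (p + 2) d - 1\<close>.  For these the bound on \<open>x + y\<close> is an equality, and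
  \<open>x + a d = p d + 4 d - 2 + \<epsilon> d\<close> is below \<open>p c d\<close>.  To match the ECH index one has to remove
  \<open>R = 2 d\<^sup>2 + (p + 1) d / 2 - 1\<close> lattice points from the rectangle \<open>[0, x] \<times> [0, d]\<close> so that the number
  of points removed from each row is a convex function of the height vanishing at \<open>0\<close>.  Such
  functions are the sums of the functions \<open>j \<mapsto> max 0 (j - (d - m))\<close> with \<open>1 \<le> m \<le> d\<close>, each of
  which removes a triangular number \<open>T\<^sub>m\<close> of points and \<open>m\<close> points from the top row.  Writing
  \<open>R = q T\<^sub>d + T\<^sub>m + k T\<^sub>1\<close> greedily keeps the top row nonempty.
\<close>

section \<open>Graphs of piecewise affine functions as convex integral paths\<close>

lemma concave_on_min:
  assumes "concave_on S f" "concave_on S g"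
  shows "concave_on S (\<lambda>t. min (f t) (g t))"
  unfolding concave_on_iff
proof (intro conjI ballI allI impI)
  show "convex S"
    using assms(1) by (rule concave_on_imp_convex)
  fix a b :: 'a and u v :: real
  assume *: "a \<in> S" "b \<in> S" "0 \<le> u" "0 \<le> v" "u + v = 1"
  then have u: "u = 1 - v"
    by simp
  have "u * f a + v * f b \<le> f (u *\<^sub>R a + v *\<^sub>R b)" "u * g a + v * g b \<le> g (u *\<^sub>R a + v *\<^sub>R b)"
    using concave_onD[OF assms(1), of v a b] concave_onD[OF assms(2), of v a b] * u by simp_all
  moreover have "u * min (f a) (g a) \<le> u * f a" "v * min (f b) (g b) \<le> v * f b"
    "u * min (f a) (g a) \<le> u * g a" "v * min (f b) (g b) \<le> v * g b"
    using * by (simp_all add: mult_left_mono)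
  ultimately show "u * min (f a) (g a) + v * min (f b) (g b) \<le> min (f (u *\<^sub>R a + v *\<^sub>R b)) (g (u *\<^sub>R a + v *\<^sub>R b))"
    by linarith
qed

lemma concave_on_affine:
  fixes \<alpha> \<beta> :: real
  assumes "convex S"
  shows "concave_on S (\<lambda>t. \<alpha> * t + \<beta>)"
  unfolding concave_on_iff
proof (intro conjI ballI allI impI assms)
  fix x y u v :: real
  assume "u + v = 1"
  then have v: "v = 1 - u"
    by simp
  show "u * (\<alpha> * x + \<beta>) + v * (\<alpha> * y + \<beta>) \<le> \<alpha> * (u *\<^sub>R x + v *\<^sub>R y) + \<beta>"
    unfolding v by (simp add: algebra_simps)
qed

lemma closed_segment_affine_graph:
  fixes u v \<alpha> \<beta> :: real
  assumes "u \<le> v"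
  shows "closed_segment (u, \<alpha> * u + \<beta>) (v, \<alpha> * v + \<beta>) = (\<lambda>t. (t, \<alpha> * t + \<beta>)) ` {u..v}"
proof -
  have "{u..v} = closed_segment u v"
    using assms by (simp add: closed_segment_eq_real_ivl)
  then show ?thesis
    unfolding closed_segment_image_interval by (simp add: image_image algebra_simps)
qed

text \<open>A vertex lying on a straight piece of the path must be an end of that piece. So covering
  the path by segments with lattice ends is enough, and the vertices need not be determined: some of
  these ends may be interior to longer straight pieces.\<close>

lemma vertices_subset_IntsI:
  assumes "\<And>z. z \<in> \<Lambda> \<Longrightarrow> \<exists>v w. v \<in> \<int> \<times> \<int> \<and> w \<in> \<int> \<times> \<int> \<and> z \<in> closed_segment v w \<and> closed_segment v w \<subseteq> \<Lambda>"
  shows "vertices \<Lambda> \<subseteq> \<int> \<times> \<int>"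
proof
  fix z assume z: "z \<in> vertices \<Lambda>"
  then have "z \<in> \<Lambda>"
    unfolding vertices_def by simp
  then obtain v w where vw: "v \<in> \<int> \<times> \<int>" "w \<in> \<int> \<times> \<int>" "z \<in> closed_segment v w" "closed_segment v w \<subseteq> \<Lambda>"
    using assms by meson
  have "\<not> (\<exists>q r. z \<in> open_segment q r \<and> closed_segment q r \<subseteq> \<Lambda>)"
    using z unfolding vertices_def mem_Collect_eq by (rule conjunct2)
  then have "z = v \<or> z = w"
    using vw(3,4) unfolding open_segment_def by blast
  then show "z \<in> \<int> \<times> \<int>"
    using vw(1,2) by (elim disjE) simp_all
qed

text \<open>The pieces in \<open>P\<close> may be degenerate or continue one another in a straight
  line, since \<open>vertices_subset_IntsI\<close> only asks for a cover. As \<open>f\<close>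
  vanishes at \<open>x\<close>, the vertical segment at the right shrinks to the endpoint.\<close>

lemma convex_integral_path_on_graph:
  fixes f :: "real \<Rightarrow> real" and P :: "(real \<times> real) set"
  assumes f: "f ` {0..real x} \<subseteq> {0..real y}" "f 0 = real y" "f (real x) = 0"
    and conc: "concave_on {0..real x} f"
    and deriv: "D \<le> 0" "(f has_real_derivative D) (at 0 within {0..real x})"
    and P: "finite P" "(\<Union>(u, v)\<in>P. {u..v}) = {0..real x}"
    and piece: "\<And>u v. (u, v) \<in> P \<Longrightarrow> u \<le> v \<and> {u, v, f u, f v} \<subseteq> \<int> \<and> (\<exists>\<alpha> \<beta>. \<forall>t\<in>{u..v}. f t = \<alpha> * t + \<beta>)"
  shows "convex_integral_path_on x y ((\<lambda>t. (t, f t)) ` {0..real x})"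
  unfolding convex_integral_path_on_def
proof (intro conjI exI[of _ f])
  let ?\<Lambda> = "(\<lambda>t. (t, f t)) ` {0..real x}"
  show "piecewise_linear_on {0..real x} f"
    unfolding piecewise_linear_on_def
  proof (rule exI[of _ "(\<lambda>(u, v). {u..v}) ` P"], intro conjI ballI)
    show "finite ((\<lambda>(u, v). {u..v}) ` P)" "\<Union>((\<lambda>(u, v). {u..v}) ` P) = {0..real x}"
      using P by auto
    fix J assume "J \<in> (\<lambda>(u, v). {u..v}) ` P"
    then obtain u v where "J = {u..v}" "(u, v) \<in> P"
      by auto
    then show "\<exists>u v. J = {u..v}" "\<exists>\<alpha> \<beta>. \<forall>t\<in>J. f t = \<alpha> * t + \<beta>"
      using piece by blast+
  qed
  show "\<exists>D\<le>0. (f has_real_derivative D) (at 0 within {0..real x})"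
    using deriv by blast
  show "?\<Lambda> = ?\<Lambda> \<union> {real x} \<times> {0..f (real x)}"
  proof -
    have "(real x, 0) \<in> ?\<Lambda>"
      using f(3) by (intro image_eqI[of _ _ "real x"]) auto
    moreover have "{real x} \<times> {0..f (real x)} = {(real x, 0)}"
      using f(3) by simp
    ultimately show ?thesis
      by (simp only: Un_insert_right Un_empty_right insert_absorb)
  qed
  show "vertices ?\<Lambda> \<subseteq> \<int> \<times> \<int>"
  proof (rule vertices_subset_IntsI)
    fix z assume "z \<in> ?\<Lambda>"
    then obtain t where t: "t \<in> {0..real x}" "z = (t, f t)"
      by blast
    then obtain u v where uv: "(u, v) \<in> P" "t \<in> {u..v}"
      using P(2) by blast
    then have sub: "{u..v} \<subseteq> {0..real x}"
      using P(2) by blast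
    obtain \<alpha> \<beta> where "u \<le> v" and lin: "\<And>t. t \<in> {u..v} \<Longrightarrow> f t = \<alpha> * t + \<beta>"
      using piece[OF uv(1)] by blast
    have "closed_segment (u, \<alpha> * u + \<beta>) (v, \<alpha> * v + \<beta>) = (\<lambda>t. (t, f t)) ` {u..v}"
      unfolding closed_segment_affine_graph[OF \<open>u \<le> v\<close>] using lin by (intro image_cong) simp_all
    moreover have "f u = \<alpha> * u + \<beta>" "f v = \<alpha> * v + \<beta>"
      using lin \<open>u \<le> v\<close> by simp_all
    ultimately have "closed_segment (u, f u) (v, f v) = (\<lambda>t. (t, f t)) ` {u..v}"
      by simp
    then have "z \<in> closed_segment (u, f u) (v, f v)" "closed_segment (u, f u) (v, f v) \<subseteq> ?\<Lambda>"
      using uv(2) sub t(2) by blast+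
    moreover have "(u, f u) \<in> \<int> \<times> \<int>" "(v, f v) \<in> \<int> \<times> \<int>"
      using piece[OF uv(1)] by auto
    ultimately show "\<exists>v w. v \<in> \<int> \<times> \<int> \<and> w \<in> \<int> \<times> \<int> \<and> z \<in> closed_segment v w \<and> closed_segment v w \<subseteq> ?\<Lambda>"
      by blast
  qed
qed (use f conc in simp_all)

section \<open>Lattice points by rows, and the path with prescribed row lengths\<close>

text \<open>The hypothesis exchanges columns for rows: \<open>G j\<close> is the abscissa of the
  last lattice point in row \<open>j\<close>, which therefore contributes \<open>G j + 1\<close>
  points.\<close>

lemma lattice_count_graph:
  fixes f :: "real \<Rightarrow> real" and G :: "nat \<Rightarrow> nat"
  assumes "\<And>i j. i \<le> x \<and> real j \<le> f (real i) \<longleftrightarrow> j \<le> y \<and> i \<le> G j"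
  shows "lattice_count \<lparr>curve = (\<lambda>t. (t, f t)) ` {0..real x}, h_edges = H\<rparr> = (\<Sum>j\<le>y. G j + 1)"
proof -
  let ?S = "SIGMA j:{..y}. {..G j}"
  let ?g = "\<lambda>(j, i). (real i, real j)"
  have "(\<int> \<times> \<int>) \<inter> enclosed_region ((\<lambda>t. (t, f t)) ` {0..real x}) = ?g ` ?S" (is "?L = _")
  proof (intro equalityI subsetI)
    fix z assume "z \<in> ?L"
    then obtain u v where z: "z = (u, v)" "u \<in> \<int>" "v \<in> \<int>" "0 \<le> v" "v \<le> f u" "0 \<le> u" "u \<le> real x"
      unfolding enclosed_region_def by auto
    then obtain i j where ij: "u = real i" "v = real j"
      by (metis Nats_altdef2 mem_Collect_eq Nats_cases)
    then have "j \<le> y \<and> i \<le> G j"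
      using z assms[of i j] by simp
    then show "z \<in> ?g ` ?S"
      using z ij by force
  next
    fix z assume "z \<in> ?g ` ?S"
    then obtain i j where "z = (real i, real j)" "i \<le> x" "real j \<le> f (real i)"
      using assms by auto
    then show "z \<in> ?L"
      unfolding enclosed_region_def by auto
  qed
  moreover have "inj_on ?g ?S"
    by (auto simp: inj_on_def)
  ultimately show ?thesis
    unfolding lattice_count_def by (simp add: card_image)
qed

lemma double_sum_atMost_nat: "2 * (\<Sum>j\<le>d. j) = d * (d + 1)" for d :: nat
  by (induction d) auto

lemma double_sum_atMost_diff_nat: "2 * (\<Sum>j\<le>d. j - e) = (d - e) * (d - e + 1)" for d :: nat
proof (induction d)
  case (Suc d)
  then show ?case
    by (cases "e \<le> d") (simp_all add: Suc_diff_le)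
qed simp

text \<open>
  A path from \<open>(0, d)\<close> to \<open>(x, 0)\<close> whose row at height \<open>j\<close> is shorter than \<open>x\<close> by
  \<open>q j + max 0 (j - (d - m)) + (if j = d then k else 0)\<close>, a convex function of \<open>j\<close>.
\<close>
lemma ex_path_lattice_count:
  fixes x d q m k :: nat
  assumes "1 \<le> q" "1 \<le> m" "m \<le> d" "q * d + m + k < x"
  obtains \<Lambda> where "convex_integral_path_on x d (curve \<Lambda>)" "h_edges \<Lambda> = {}"
    "2 * lattice_count \<Lambda> + q * (d * (d + 1)) + m * (m + 1) + 2 * k = 2 * ((x + 1) * (d + 1))"
proof -
  define e where "e = d - m"
  have e: "e + 1 \<le> d" "m = d - e"
    using assms unfolding e_def by auto
  \<comment> \<open>Let \<open>s\<close> be the distance from the right end \<open>x\<close>. The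
    amount by which the row at real height \<open>y\<close> is shorter than \<open>x\<close> is the
    largest of \<open>q y\<close>, \<open>(q + 1) y - e\<close> and
    \<open>(q + 1 + k) y - e - k (d - 1)\<close>. \<open>F\<close> inverts this deficit and is cut
    off at height \<open>d\<close>; \<open>s1\<close>, \<open>s2\<close>, \<open>s3\<close> are the
    deficits at the heights \<open>e\<close>, \<open>d - 1\<close>, \<open>d\<close>, where the
    active term changes. The last term only acts above height \<open>d - 1\<close>, so among integer
    rows it costs points in the top row alone.\<close>
  define l where "l = (\<lambda>s. (s + real e + real k * (real d - 1)) / (real q + 1 + real k))"
  define F where "F = (\<lambda>s. min (real d) (min (s / real q) (min ((s + real e) / (real q + 1)) (l s))))"
  define f where "f = (\<lambda>t. F (real x - t))"
  define s1 where "s1 = real q * real e"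
  define s2 where "s2 = (real q + 1) * (real d - 1) - real e"
  define s3 where "s3 = (real q + 1) * real d - real e + real k"
  have qpos: "real q \<ge> 1" "real d \<ge> real e + 1"
    using assms e by (auto simp flip: of_nat_Suc)
  have s12: "s1 \<le> s2"
  proof -
    have "0 \<le> (real q + 1) * (real d - 1 - real e)"
      using qpos by simp
    then show ?thesis
      unfolding s1_def s2_def by (simp add: algebra_simps)
  qed
  have s01: "0 \<le> s1" and s23: "s2 \<le> s3"
    unfolding s1_def s2_def s3_def using qpos by (auto simp: algebra_simps)
  have s3x: "s3 < real x"
  proof -
    have "s3 = real (q * d + m + k)"
      unfolding s3_def using e by (simp add: algebra_simps of_nat_diff)
    then show ?thesis
      using assms(4) by (simp only: of_nat_less_iff)
  qed
  have l_le: "y \<le> l s \<longleftrightarrow> y * (real q + 1 + real k) \<le> s + real e + real k * (real d - 1)" for s y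
    unfolding l_def by (subst pos_le_divide_eq) (use qpos in auto)
  have le_F: "y \<le> F s \<longleftrightarrow> y \<le> real d \<and> y * real q \<le> s \<and> y * (real q + 1) \<le> s + real e
      \<and> y * (real q + 1 + real k) \<le> s + real e + real k * (real d - 1)" for s y
  proof -
    have "y \<le> s / real q \<longleftrightarrow> y * real q \<le> s"
      "y \<le> (s + real e) / (real q + 1) \<longleftrightarrow> y * (real q + 1) \<le> s + real e"
      using qpos by (auto simp: pos_le_divide_eq)
    then show ?thesis
      unfolding F_def using l_le by auto
  qed
  have F_le: "F s \<le> real d" "F s \<le> s / real q" "F s \<le> (s + real e) / (real q + 1)" "F s \<le> l s" for s
    unfolding F_def by auto
  have kd: "0 \<le> real k * (real d - 1)"
    using qpos by simp
  \<comment> \<open>\<open>F1\<close> to \<open>F4\<close> identify the bound that attains the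
    minimum between consecutive breakpoints. In \<open>F1\<close> to \<open>F3\<close> the height
    \<open>y\<close> on the line in question is first located between the heights of the
    breakpoints, which makes the other bounds weaker.\<close>
  have F1: "F s = s / real q" if "0 \<le> s" "s \<le> s1" for s
  proof (rule antisym)
    define y where "y = s / real q"
    have y: "y * real q = s" "0 \<le> y"
      unfolding y_def using qpos that by auto
    have "y * real q \<le> real e * real q"
      using that y unfolding s1_def by (simp add: mult.commute)
    then have "y \<le> real e"
      using qpos by simp
    moreover from this have "real k * y \<le> real k * (real d - 1)"
      using qpos by (intro mult_left_mono) auto
    ultimately show "s / real q \<le> F s"
      unfolding le_F y_def[symmetric] using y qpos by (simp add: algebra_simps)
  qed (rule F_le)
  have F2: "F s = (s + real e) / (real q + 1)" if "s1 \<le> s" "s \<le> s2" for s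
  proof (rule antisym)
    define y where "y = (s + real e) / (real q + 1)"
    have y: "y * (real q + 1) = s + real e"
      unfolding y_def using qpos by auto
    have "real e * (real q + 1) \<le> y * (real q + 1)" "y * (real q + 1) \<le> (real d - 1) * (real q + 1)"
      using that unfolding y s1_def s2_def by (simp_all add: algebra_simps)
    then have "real e \<le> y" "y \<le> real d - 1"
      using qpos by (simp_all add: mult_le_cancel_right)
    moreover from this have "real k * y \<le> real k * (real d - 1)"
      by (intro mult_left_mono) auto
    ultimately show "(s + real e) / (real q + 1) \<le> F s"
      unfolding le_F y_def[symmetric] using y qpos by (simp add: algebra_simps)
  qed (rule F_le)
  have F3: "F s = l s" if "s2 \<le> s" "s \<le> s3" for s
  proof (rule antisym)
    define y where "y = l s"
    have y: "y * (real q + 1 + real k) = s + real e + real k * (real d - 1)"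
      unfolding y_def l_def using qpos by auto
    have "(real d - 1) * (real q + 1 + real k) \<le> y * (real q + 1 + real k)"
      "y * (real q + 1 + real k) \<le> real d * (real q + 1 + real k)"
      using that unfolding y s2_def s3_def by (simp_all add: algebra_simps)
    then have "real d - 1 \<le> y" "y \<le> real d"
      using qpos by (simp_all add: mult_le_cancel_right)
    moreover from this have "real k * (real d - 1) \<le> real k * y"
      by (intro mult_left_mono) auto
    ultimately show "l s \<le> F s"
      unfolding le_F y_def[symmetric] using y qpos by (simp add: algebra_simps)
  qed (rule F_le)
  have F4: "F s = real d" if "s3 \<le> s" for s
  proof (rule antisym)
    show "real d \<le> F s"
      unfolding le_F using that qpos unfolding s3_def by (simp add: algebra_simps)
  qed (rule F_le)
  have vals: "F 0 = 0" "F s1 = real e" "F s2 = real d - 1" "F s3 = real d"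
    using F1[of 0] F1[of s1] F2[of s2] F4[of s3] s01 s12 qpos
    unfolding s1_def s2_def by simp_all
  have F_nonneg: "0 \<le> F s" if "0 \<le> s" for s
    using that kd le_F[of 0 s] by simp
  \<comment> \<open>A minimum of affine functions of \<open>t\<close>, in the form from which
    \<open>concave_on_min\<close> and \<open>concave_on_affine\<close> give concavity.\<close>
  have f_eq: "f t = min (0 * t + real d) (min ((- 1 / real q) * t + real x / real q)
      (min ((- 1 / (real q + 1)) * t + (real x + real e) / (real q + 1))
        ((- 1 / (real q + 1 + real k)) * t
          + (real x + real e + real k * (real d - 1)) / (real q + 1 + real k))))" for t
    unfolding f_def F_def l_def by (simp add: diff_divide_distrib add_divide_distrib)
  \<comment> \<open>The breakpoints appear in reverse order because \<open>t = x - s\<close>. The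
    third piece degenerates to a point when \<open>m = 1\<close>, the fourth when
    \<open>m = d\<close>.\<close>
  define P where "P = {(0, real x - s3), (real x - s3, real x - s2), (real x - s2, real x - s1), (real x - s1, real x)}"
  have path: "convex_integral_path_on x d ((\<lambda>t. (t, f t)) ` {0..real x})"
  proof (rule convex_integral_path_on_graph[where P = P and D = 0])
    show "f ` {0..real x} \<subseteq> {0..real d}"
      unfolding f_def using F_nonneg F_le(1) by auto
    show "f 0 = real d" "f (real x) = 0"
      unfolding f_def using F4[of "real x"] s3x vals by auto
    show "concave_on {0..real x} f"
      unfolding f_eq[abs_def] by (intro concave_on_min concave_on_affine) auto
    \<comment> \<open>The strict inequality \<open>s3 < x\<close> leaves a horizontal edge of
      positive length at the top, so \<open>f\<close> is constant near \<open>0\<close>.\<close>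
    have "((\<lambda>t. real d) has_real_derivative 0) (at 0 within {0..real x})"
      by simp
    then show "(f has_real_derivative 0) (at 0 within {0..real x})"
    proof (rule has_field_derivative_transform_within[where d = "real x - s3"])
      fix t assume "t \<in> {0..real x}" "dist t 0 < real x - s3"
      then show "real d = f t"
        unfolding f_def by (subst F4) auto
    qed (use s3x in auto)
    show "(\<Union>(u, v)\<in>P. {u..v}) = {0..real x}"
      unfolding P_def using s01 s12 s23 s3x by auto
    fix u v assume uv: "(u, v) \<in> P"
    have ints: "s1 \<in> \<int>" "s2 \<in> \<int>" "s3 \<in> \<int>"
      unfolding s1_def s2_def s3_def by auto
    have "\<exists>\<alpha> \<beta>. \<forall>t\<in>{u..v}. f t = \<alpha> * t + \<beta>"
    proof -
      from uv consider "u = 0" "v = real x - s3" | "u = real x - s3" "v = real x - s2"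
        | "u = real x - s2" "v = real x - s1" | "u = real x - s1" "v = real x"
        unfolding P_def by auto
      then show ?thesis
      proof cases
        case 1
        then have "\<forall>t\<in>{u..v}. f t = 0 * t + real d"
          unfolding f_def by (auto intro!: F4)
        then show ?thesis by blast
      next
        case 2
        then have "\<forall>t\<in>{u..v}. f t = l (real x - t)"
          unfolding f_def by (auto intro!: F3)
        then have "\<forall>t\<in>{u..v}. f t = (- 1 / (real q + 1 + real k)) * t
          + (real x + real e + real k * (real d - 1)) / (real q + 1 + real k)"
          unfolding l_def by (simp add: diff_divide_distrib add_divide_distrib)
        then show ?thesis by blast
      next
        case 3
        then have "\<forall>t\<in>{u..v}. f t = (real x - t + real e) / (real q + 1)"
          unfolding f_def by (auto intro!: F2)
        then have "\<forall>t\<in>{u..v}. f t = (- 1 / (real q + 1)) * t + (real x + real e) / (real q + 1)"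
          by (simp add: diff_divide_distrib add_divide_distrib)
        then show ?thesis by blast
      next
        case 4
        then have "\<forall>t\<in>{u..v}. f t = (real x - t) / real q"
          unfolding f_def by (auto intro!: F1)
        then have "\<forall>t\<in>{u..v}. f t = (- 1 / real q) * t + real x / real q"
          by (simp add: diff_divide_distrib)
        then show ?thesis by blast
      qed
    qed
    moreover have "u \<le> v \<and> {u, v, f u, f v} \<subseteq> \<int>"
      using uv ints s01 s12 s23 s3x vals F4[of "real x"] unfolding P_def f_def by auto
    ultimately show "u \<le> v \<and> {u, v, f u, f v} \<subseteq> \<int> \<and> (\<exists>\<alpha> \<beta>. \<forall>t\<in>{u..v}. f t = \<alpha> * t + \<beta>)"
      by simp
  qed (auto simp: P_def)
  \<comment> \<open>The deficit of an integer row; the truncated \<open>j - e\<close> is the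
    function \<open>max 0 (j - (d - m))\<close>. By \<open>\<rho>_le\<close>, the subtraction
    \<open>x - \<rho> j\<close> is not truncated for \<open>j \<le> d\<close>.\<close>
  define \<rho> where "\<rho> = (\<lambda>j. q * j + (j - e) + (if j = d then k else 0))"
  have \<rho>_le: "\<rho> j \<le> x" if "j \<le> d" for j
  proof -
    have "q * j \<le> q * d"
      using that by simp
    moreover have "j - e \<le> m"
      using that e by simp
    moreover have "\<rho> j \<le> q * j + (j - e) + k"
      unfolding \<rho>_def by simp
    ultimately show ?thesis
      using assms(4) by linarith
  qed
  have count: "i \<le> x \<and> real j \<le> f (real i) \<longleftrightarrow> j \<le> d \<and> i \<le> x - \<rho> j" for i j
  proof -
    have "real j \<le> f (real i) \<longleftrightarrow> j \<le> d \<and> i + \<rho> j \<le> x"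
    proof -
      \<comment> \<open>The cases follow the pieces of \<open>F\<close>. For \<open>j < d\<close>
        the bound involving \<open>k\<close> follows from the second one because
        \<open>j \<le> d - 1\<close>.\<close>
      consider "j \<le> e" "j < d" | "e < j" "j < d" | "j = d" | "d < j"
        by linarith
      then show ?thesis
      proof cases
        case 1
        then have "real k * real j \<le> real k * (real d - 1)"
          by (intro mult_left_mono) auto
        moreover have "\<rho> j = q * j" "real j \<le> real e"
          using 1 unfolding \<rho>_def by auto
        ultimately show ?thesis
          unfolding f_def le_F of_nat_le_iff[where 'a = real, symmetric] using 1
          by (auto simp: algebra_simps)
      next
        case 2
        then have "real k * real j \<le> real k * (real d - 1)"
          by (intro mult_left_mono) auto
        moreover have "real (\<rho> j) = real q * real j + real j - real e" "real e \<le> real j"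
          using 2 unfolding \<rho>_def by auto
        ultimately show ?thesis
          unfolding f_def le_F of_nat_le_iff[where 'a = real, symmetric] using 2
          by (auto simp: algebra_simps)
      next
        case 3
        have "real (\<rho> d) = real q * real d + real d - real e + real k"
          using e unfolding \<rho>_def by (auto simp: of_nat_diff)
        then show ?thesis
          unfolding f_def le_F of_nat_le_iff[where 'a = real, symmetric] 3 using qpos
          by (auto simp: algebra_simps)
      next
        case 4
        then show ?thesis
          unfolding f_def le_F by auto
      qed
    qed
    then show ?thesis
      using \<rho>_le[of j] by auto
  qed
  have "lattice_count \<lparr>curve = (\<lambda>t. (t, f t)) ` {0..real x}, h_edges = {}\<rparr> = (\<Sum>j\<le>d. x - \<rho> j + 1)"
    using count by (rule lattice_count_graph)
  moreover have "(\<Sum>j\<le>d. x - \<rho> j + 1) + (\<Sum>j\<le>d. \<rho> j) = (x + 1) * (d + 1)"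
  proof -
    have "(\<Sum>j\<le>d. x - \<rho> j + 1) + (\<Sum>j\<le>d. \<rho> j) = (\<Sum>j\<le>d. x + 1)"
      unfolding sum.distrib[symmetric] using \<rho>_le by (intro sum.cong) auto
    then show ?thesis by simp
  qed
  moreover have "2 * (\<Sum>j\<le>d. \<rho> j) = q * (d * (d + 1)) + m * (m + 1) + 2 * k"
  proof -
    have "(\<Sum>j\<le>d. \<rho> j) = q * (\<Sum>j\<le>d. j) + (\<Sum>j\<le>d. j - e) + k"
      unfolding \<rho>_def by (simp add: sum.distrib sum_distrib_left)
    then show ?thesis
      using double_sum_atMost_nat[of d] double_sum_atMost_diff_nat[of e d] e(2)
      by (simp add: algebra_simps)
  qed
  ultimately show ?thesis
    using path by (intro that[of "\<lparr>curve = (\<lambda>t. (t, f t)) ` {0..real x}, h_edges = {}\<rparr>"]) auto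
qed

section \<open>The generator \<open>e_power p 2 d\<close>: path, lattice count, exponent and
  action\<close>

lemma e_power_curve:
  assumes "0 < p" "0 < d"
  shows "curve (e_power p 2 d) = (\<lambda>t. (t, - (2 / real p) * t + 2 * real d)) ` {0..real (p * d)}"
proof -
  have "closed_segment (0, real (d * 2)) (real (d * p), 0) =
    closed_segment (0, - (2 / real p) * 0 + 2 * real d) (real (p * d), - (2 / real p) * real (p * d) + 2 * real d)"
    using assms by (simp add: mult.commute)
  then show ?thesis
    unfolding e_power_def by (subst closed_segment_affine_graph[symmetric]) auto
qed

lemma convex_integral_path_on_e_power:
  assumes "0 < p" "0 < d"
  shows "convex_integral_path_on (p * d) (2 * d) (curve (e_power p 2 d))"
  unfolding e_power_curve[OF assms]
proof (rule convex_integral_path_on_graph[where P = "{(0, real (p * d))}" and D = "- (2 / real p)"])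
  let ?f = "\<lambda>t. - (2 / real p) * t + 2 * real d"
  show "?f ` {0..real (p * d)} \<subseteq> {0..real (2 * d)}"
    using assms by (auto simp: field_simps)
  show "concave_on {0..real (p * d)} ?f"
    by (rule concave_on_affine) simp
  show "(?f has_real_derivative - (2 / real p)) (at 0 within {0..real (p * d)})"
    using assms by (auto intro!: derivative_eq_intros)
  fix u v assume "(u, v) \<in> {(0::real, real (p * d))}"
  then have "u = 0" "v = real (p * d)"
    by auto
  then have "u \<le> v" "{u, v, ?f u, ?f v} \<subseteq> \<int>"
    using assms by auto
  then show "u \<le> v \<and> {u, v, ?f u, ?f v} \<subseteq> \<int> \<and> (\<exists>\<alpha> \<beta>. \<forall>t\<in>{u..v}. ?f t = \<alpha> * t + \<beta>)"
    by blast
qed (use assms in auto)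

text \<open>Row \<open>j\<close> ends at \<open>p (2 d - j) / 2\<close> rounded down. After
  reversing the order of the rows, passing from \<open>d\<close> to \<open>d + 1\<close> appends two
  rows: one whose length is an exact half, and one where the oddness of \<open>p\<close> makes the
  rounding explicit.\<close>

lemma double_lattice_count_e_power:
  assumes "odd p" "0 < d"
  shows "2 * lattice_count (e_power p 2 d) = 2 * (p * d\<^sup>2) + p * d + 3 * d + 2"
proof -
  have "0 < p"
    using assms(1) by (rule odd_pos)
  have "lattice_count (e_power p 2 d)
      = lattice_count \<lparr>curve = (\<lambda>t. (t, - (2 / real p) * t + 2 * real d)) ` {0..real (p * d)}, h_edges = {}\<rparr>"
    using e_power_curve[OF \<open>0 < p\<close> assms(2)] unfolding lattice_count_def by simp
  also have "\<dots> = (\<Sum>j\<le>2 * d. p * (2 * d - j) div 2 + 1)"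
  proof (rule lattice_count_graph)
    fix i j
    have "real j \<le> - (2 / real p) * real i + 2 * real d \<longleftrightarrow> real p * real j + 2 * real i \<le> 2 * real p * real d"
      using \<open>0 < p\<close> by (auto simp: field_simps)
    also have "\<dots> \<longleftrightarrow> p * j + 2 * i \<le> 2 * p * d"
      unfolding of_nat_le_iff[where 'a = real, symmetric] by simp
    also have "i \<le> p * d \<and> \<dots> \<longleftrightarrow> j \<le> 2 * d \<and> i \<le> p * (2 * d - j) div 2"
    proof (cases "j \<le> 2 * d")
      case True
      then have "p * j + p * (2 * d - j) = 2 * (p * d)"
        by (simp flip: distrib_left)
      then show ?thesis
        using True by (auto simp: ac_simps)
    next
      case False
      then have "p * (2 * d) < p * j"
        using \<open>0 < p\<close> by simp
      then have "\<not> p * j + 2 * i \<le> 2 * p * d"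
        by (simp only: not_le ac_simps)
      then show ?thesis
        using False by blast
    qed
    finally show "i \<le> p * d \<and> real j \<le> - (2 / real p) * real i + 2 * real d \<longleftrightarrow> j \<le> 2 * d \<and> i \<le> p * (2 * d - j) div 2"
      by simp
  qed
  also have "\<dots> = (\<Sum>j\<le>2 * d. p * j div 2 + 1)"
    by (rule sum.reindex_bij_witness[of _ "\<lambda>j. 2 * d - j" "\<lambda>j. 2 * d - j"]) auto
  also have "2 * \<dots> = 2 * (p * d\<^sup>2) + p * d + 3 * d + 2"
  proof -
    obtain h where h: "p = 2 * h + 1"
      using assms(1) by (rule oddE)
    show ?thesis
    proof (induction d)
      case (Suc d)
      have "p * (2 * d + 1) div 2 = 2 * h * d + h + d"
        unfolding h by (simp add: algebra_simps)
      moreover have "p * (2 * d + 2) div 2 = p * d + p"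
        by (simp add: algebra_simps)
      moreover have "(\<Sum>j\<le>2 * Suc d. p * j div 2 + 1) = (\<Sum>j\<le>2 * d. p * j div 2 + 1)
          + (p * (2 * d + 1) div 2 + 1) + (p * (2 * d + 2) div 2 + 1)"
        by simp
      ultimately show ?case
        using Suc.IH unfolding h by (simp add: algebra_simps power2_eq_square)
    qed simp
  qed
  finally show ?thesis .
qed

text \<open>For a convex path, not being interior to a segment in the path means being an extreme
  point. The exact vertices are wanted here because the total exponent sums over all edges.\<close>

lemma vertices_closed_segment:
  assumes "A \<noteq> B"
  shows "vertices (closed_segment A B) = {A, B}"
proof -
  have "z \<in> vertices (closed_segment A B) \<longleftrightarrow> z extreme_point_of closed_segment A B" for z
  proof
    assume z: "z \<in> vertices (closed_segment A B)"
    then have "z \<notin> open_segment A B" "z \<in> closed_segment A B"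
      unfolding vertices_def by blast+
    then show "z extreme_point_of closed_segment A B"
      by (auto simp: extreme_point_of_segment open_segment_def)
  next
    assume "z extreme_point_of closed_segment A B"
    then show "z \<in> vertices (closed_segment A B)"
      unfolding vertices_def extreme_point_of_def by (blast dest: subsetD[OF _ ends_in_segment(1)] subsetD[OF _ ends_in_segment(2)])
  qed
  then show ?thesis
    by (auto simp: extreme_point_of_segment)
qed

lemma total_exponent_e_power:
  assumes "coprime p q" "0 < p" "0 < q" "0 < d"
  shows "total_exponent (e_power p q d) = d"
proof -
  let ?A = "(0::real, real (d * q))" and ?B = "(real (d * p), 0::real)"
  have "?A \<noteq> ?B"
    using assms by simp
  have "0 < real (d * p)" "0 < real (d * q)"
    using assms by simp_all
  then have "edges (closed_segment ?A ?B) = {(?A, ?B)}"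
    unfolding edges_def vertices_closed_segment[OF \<open>?A \<noteq> ?B\<close>] by (auto simp del: of_nat_mult)
  then have "total_exponent (e_power p q d) = nat (gcd (int (d * p)) (int (d * q)))"
    unfolding total_exponent_def e_power_def edge_exponent_def by (simp flip: of_nat_mult)
  also have "\<dots> = d"
    using assms(1) by (simp only: gcd_int_int_eq nat_int gcd_mult_distrib_nat[symmetric]) simp
  finally show ?thesis .
qed

text \<open>With \<open>b = p / 2\<close> the functional \<open>c x + b c y\<close> is constant
  along the edge, whose slope is \<open>- 2 / p\<close>, so the supremum is over a single
  value.\<close>

lemma ellipsoid_action_e_power:
  "ellipsoid_action (real p / 2) c (e_power p 2 d) = real p * c * real d"
proof -
  have "c * x + real p / 2 * c * y = real p * c * real d"
    if "(x, y) \<in> closed_segment (0, real (d * 2)) (real (d * p), 0)" for x y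
  proof -
    from that obtain u where "(x, y) = (1 - u) *\<^sub>R (0, real (d * 2)) + u *\<^sub>R (real (d * p), 0)"
      unfolding in_segment by blast
    then have xy: "x = u * (real d * real p)" "y = (1 - u) * (real d * 2)"
      by simp_all
    show ?thesis
      unfolding xy by (simp add: algebra_simps)
  qed
  then have "(\<lambda>(x, y). c * x + real p / 2 * c * y) ` curve (e_power p 2 d) = {real p * c * real d}"
    unfolding e_power_def by (auto simp: image_iff intro!: bexI[of _ "(0, real (d * 2))"])
  then show ?thesis
    unfolding ellipsoid_action_def by simp
qed

section \<open>Arithmetic choice of the lattice points to remove\<close>

text \<open>Take the largest triangular number up to \<open>n\<close>, with index \<open>m\<close>.
  The next one is larger by \<open>m + 1\<close>, so the remainder \<open>k\<close> is at most
  \<open>m\<close>.\<close>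

lemma ex_triangular_plus_remainder:
  fixes n :: nat
  assumes "1 \<le> n"
  shows "\<exists>m k. 1 \<le> m \<and> k \<le> m \<and> 2 * n = m * (m + 1) + 2 * k"
  using assms
proof (induction n rule: dec_induct)
  case base
  show ?case
    by (intro exI[of _ 1] exI[of _ 0]) simp
next
  case (step n)
  then obtain m k where mk: "1 \<le> m" "k \<le> m" "2 * n = m * (m + 1) + 2 * k"
    by blast
  show ?case
  proof (cases "k < m")
    case True
    then show ?thesis
      using mk by (intro exI[of _ m] exI[of _ "k + 1"]) simp
  next
    case False
    then show ?thesis
      using mk by (intro exI[of _ "m + 1"] exI[of _ 0]) (simp add: algebra_simps)
  qed
qed

text \<open>The equation says, doubled, that \<open>R\<close> points are removed; the strict bound
  is what \<open>ex_path_lattice_count\<close> asks for when \<open>x = (p + 2) d - 1\<close>. It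
  follows from \<open>q \<le> p\<close> and \<open>m + k \<le> 2 d - 2\<close>.\<close>

lemma ex_removed_rows:
  fixes d p :: nat
  assumes "2 \<le> d" "odd p" "2 < p"
  obtains q m k where "1 \<le> q" "1 \<le> m" "m \<le> d" "q * d + m + k + 1 < (p + 2) * d"
    "q * (d * (d + 1)) + m * (m + 1) + 2 * k + 2 = 4 * d\<^sup>2 + (p + 1) * d"
proof -
  obtain h where h: "p = 2 * h + 1"
    using assms(2) by (rule oddE)
  define T where "T = (\<Sum>j\<le>d. j)"
  have T: "2 * T = d * d + d"
    unfolding T_def double_sum_atMost_nat by simp
  have "0 < T"
    using T assms(1) by (cases T) auto
  define R where "R = 2 * d * d + (h + 1) * d - 1"
  have dd: "2 * d \<le> d * d"
    using assms(1) by simp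
  have hd: "d \<le> h * d"
    using assms h by simp
  have R: "R + 1 = 2 * d * d + h * d + d"
    unfolding R_def using assms(1) by (simp add: algebra_simps)
  \<comment> \<open>Dividing \<open>R - 1\<close> instead of \<open>R\<close> puts the remainder
    \<open>n\<close> between \<open>1\<close> and \<open>T\<close>, so that \<open>m\<close> comes
    out positive.\<close>
  define q where "q = (R - 1) div T"
  define n where "n = (R - 1) mod T + 1"
  have "R = R - 1 + 1"
    unfolding R_def using assms(1) by simp
  then have qn: "R = q * T + n"
    unfolding q_def n_def using div_mult_mod_eq[of "R - 1" T] by linarith
  have n: "1 \<le> n" "n \<le> T"
    unfolding n_def using \<open>0 < T\<close> by (auto simp: Suc_le_eq)
  have "T \<le> R - 1"
    using R T dd hd by linarith
  then have q1: "1 \<le> q"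
    unfolding q_def using \<open>0 < T\<close> by (simp add: Suc_le_eq div_greater_zero_iff)
  \<comment> \<open>This yields \<open>q \<le> p\<close>. From \<open>p > 2\<close> comes
    \<open>h \<ge> 1\<close>, hence
    \<open>2 d^2 + h d + d \<le> (h + 1) (d^2 + d) = (p + 1) T\<close>.\<close>
  have "R < (p + 1) * T + 1"
  proof -
    have "(p + 1) * T = (h + 1) * (d * d + d)"
      unfolding h T[symmetric] by simp
    also have "\<dots> = h * (d * d) + h * d + d * d + d"
      by (simp add: algebra_simps)
    finally have "(p + 1) * T = h * (d * d) + h * d + d * d + d" .
    moreover have "d * d \<le> h * (d * d)"
      using assms h by simp
    ultimately show ?thesis
      using R by linarith
  qed
  then have "(R - 1) div T < p + 1"
    using \<open>0 < T\<close> R dd by (subst div_less_iff_less_mult) auto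
  then have qp: "q * d \<le> p * d"
    unfolding q_def by simp
  obtain m k where mk: "1 \<le> m" "k \<le> m" "2 * n = m * (m + 1) + 2 * k"
    using ex_triangular_plus_remainder n(1) by blast
  have sq: "m * (m + 1) + 2 * k \<le> d * (d + 1)"
    using mk(3) n(2) T by (simp add: algebra_simps)
  have "m \<le> d"
  proof (rule ccontr)
    assume "\<not> m \<le> d"
    then have "d * (d + 1) < m * (m + 1)"
      by (intro mult_strict_mono) auto
    then show False
      using sq by simp
  qed
  \<comment> \<open>If \<open>m = d\<close>, then \<open>sq\<close> forces \<open>k = 0\<close> and
    \<open>d \<ge> 2\<close> suffices; otherwise \<open>k \<le> m \<le> d - 1\<close>.\<close>
  moreover have "m + k + 2 \<le> 2 * d"
  proof (cases "m = d")
    case True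
    then show ?thesis
      using sq assms(1) by simp
  next
    case False
    then show ?thesis
      using \<open>m \<le> d\<close> mk(2) by linarith
  qed
  moreover from this have "q * d + m + k + 1 < (p + 2) * d"
    using qp unfolding distrib_right by linarith
  moreover have "q * (d * (d + 1)) + m * (m + 1) + 2 * k + 2 = 4 * d\<^sup>2 + (p + 1) * d"
  proof -
    have "q * (d * (d + 1)) + m * (m + 1) + 2 * k = q * (2 * T) + 2 * n"
      unfolding T mk(3) by simp
    also have "\<dots> = 2 * R"
      unfolding qn by (simp add: algebra_simps)
    finally show ?thesis
      using R unfolding h by (simp add: algebra_simps power2_eq_square)
  qed
  ultimately show ?thesis
    using q1 mk(1) by (intro that)
qed

theorem proposition3p4:
  fixes \<epsilon> a b c :: real and d\<^sub>0 p :: nat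
  assumes "\<epsilon> > 0"
    and "d\<^sub>0 \<ge> 2"
    and "a = (2 * real d\<^sub>0 - 1) / real d\<^sub>0 + \<epsilon>"
    and "c > 0"
    and "odd p" and "p > 2"
    and "b = real p / 2"
    and "2 * a + real p - \<epsilon> / 2 < real p * c"
  shows "\<exists>\<Lambda>. convex_generator \<Lambda> \<and> generator_le a b c \<Lambda> (e_power p 2 d\<^sub>0)"
proof -
  define x where "x = (p + 2) * d\<^sub>0 - 1"
  let ?\<Lambda>' = "e_power p 2 d\<^sub>0"
  have pos: "0 < p" "0 < d\<^sub>0"
    using assms by auto
  have x: "x + 1 = (p + 2) * d\<^sub>0"
    unfolding x_def using pos by simp
  obtain q m k where qmk: "1 \<le> q" "1 \<le> m" "m \<le> d\<^sub>0" "q * d\<^sub>0 + m + k + 1 < (p + 2) * d\<^sub>0"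
    "q * (d\<^sub>0 * (d\<^sub>0 + 1)) + m * (m + 1) + 2 * k + 2 = 4 * d\<^sub>0\<^sup>2 + (p + 1) * d\<^sub>0"
    using ex_removed_rows[of d\<^sub>0 p] assms by blast
  then have "q * d\<^sub>0 + m + k < x"
    using x by simp
  then obtain \<Lambda> where \<Lambda>: "convex_integral_path_on x d\<^sub>0 (curve \<Lambda>)" "h_edges \<Lambda> = {}"
    "2 * lattice_count \<Lambda> + q * (d\<^sub>0 * (d\<^sub>0 + 1)) + m * (m + 1) + 2 * k = 2 * ((x + 1) * (d\<^sub>0 + 1))"
    using ex_path_lattice_count[of q m d\<^sub>0 k x] qmk by blast
  \<comment> \<open>Neither generator has an edge labeled \<open>h\<close>, so equal lattice counts
    give equal indices. Writing \<open>d\<close> for \<open>d\<^sub>0\<close>, taking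
    \<open>4 d^2 + (p + 1) d - 2\<close> from the doubled rectangle count
    \<open>2 (p + 2) d (d + 1)\<close> leaves \<open>2 p d^2 + p d + 3 d + 2\<close>.\<close>
  have "2 * lattice_count \<Lambda> = 2 * lattice_count ?\<Lambda>'"
    unfolding double_lattice_count_e_power[OF \<open>odd p\<close> pos(2)]
    using \<Lambda>(3) qmk(5) unfolding x by (simp add: algebra_simps power2_eq_square)
  then have index: "ech_index \<Lambda> = ech_index ?\<Lambda>'"
    unfolding ech_index_def h_count_def \<Lambda>(2) by (simp add: e_power_def)
  have path': "convex_integral_path_on (p * d\<^sub>0) (2 * d\<^sub>0) (curve ?\<Lambda>')"
    by (rule convex_integral_path_on_e_power[OF pos])
  have gen: "convex_generator \<Lambda>"
    unfolding convex_generator_def convex_integral_path_def using \<Lambda> by auto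
  have gen': "convex_generator ?\<Lambda>'" "h_edges ?\<Lambda>' = {}"
    using path' unfolding convex_generator_def convex_integral_path_def by (auto simp: e_power_def)
  have real_x: "real x = (real p + 2) * real d\<^sub>0 - 1"
    using arg_cong[OF x, of real] by (simp add: algebra_simps)
  have ends: "x_end \<Lambda> = real x" "y_end \<Lambda> = real d\<^sub>0"
    "x_end ?\<Lambda>' = real p * real d\<^sub>0" "y_end ?\<Lambda>' = 2 * real d\<^sub>0"
    using x_end_eq[OF \<Lambda>(1)] y_end_eq[OF \<Lambda>(1)] x_end_eq[OF path'] y_end_eq[OF path'] by auto
  have ad: "a * real d\<^sub>0 = 2 * real d\<^sub>0 - 1 + \<epsilon> * real d\<^sub>0"
    using pos assms(3) by (simp add: field_simps)
  have "polydisk_action a \<Lambda> \<le> ellipsoid_action b c ?\<Lambda>'"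
  proof -
    \<comment> \<open>With \<open>d\<close> for \<open>d\<^sub>0\<close>, the left side is
      \<open>p d + 4 d - 2 + (3 / 2) \<epsilon> d\<close>, which exceeds the action of
      \<open>\<Lambda>\<close> by \<open>\<epsilon> d / 2\<close>.\<close>
    have "(2 * a + real p - \<epsilon> / 2) * real d\<^sub>0 \<le> real p * c * real d\<^sub>0"
      using assms(8) by (intro mult_right_mono) auto
    moreover have "0 \<le> \<epsilon> * real d\<^sub>0"
      using assms(1) by simp
    ultimately show ?thesis
      unfolding polydisk_action_def ends assms(7) ellipsoid_action_e_power real_x
      using ad by (simp add: algebra_simps)
  qed
  moreover have "coprime p 2"
    using \<open>odd p\<close> by simp
  ultimately have "generator_le a b c \<Lambda> ?\<Lambda>'"
    unfolding generator_le_def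
    using gen gen' index pos total_exponent_e_power[of p 2 d\<^sub>0] \<Lambda>(2)
    by (simp add: ends real_x h_count_def algebra_simps)
  then show ?thesis
    using gen by blast
qed

end
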